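(* Let $k\ge 1$ and $n\ge 1$ be integers and let $U_n=K_3\times P_n$. If the $3n$ vertices of $U_n$ are colored uniformly and independently with $k$ colors, the expected number of blocks is $$\mathbb{E}[X_k(U_n)]=\frac{k^{3n-5}\left((1 - 3 k^2 + 3 k^4) -(1 - k)^3 (1 + 3 k + 3 k^2) n\right)}{k^{3n}}.$$
   Context: $K_m$ is the complete graph on $m$ vertices and $P_n$ the path graph on $n$ vertices. The product $G_1\times G_2$ of graphs $G_1=(V_1,E_1)$, $G_2=(V_2,E_2)$ is the Cartesian product: its vertex set is $V_1\times V_2$, and $(v_1,v_2),(w_1,w_2)$ are adjacent iff ($v_1=w_1$ and $\{v_2,w_2\}\in E_2$) or ($v_2=w_2$ and $\{v_1,w_1\}\in E_1$). Given a coloring of the vertices of a finite graph $G$ with $k$ colors, the blocks are the connected components of the subgraph of $G$ formed by all vertices and all edges whose two endpoints have the same color. $X_k(G)$ denotes the number of blocks when each vertex of $G$ receives independently a uniformly random color among $k$ colors. *)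

theory Defs
  imports "HOL-Probability.Probability"
begin

record 'a ugraph =
  verts :: "'a set"
  edges :: "'a set set"

definition complete_ugraph :: "nat \<Rightarrow> nat ugraph" where
  "complete_ugraph m = \<lparr>verts = {..<m}, edges = {{i, j} |i j. i < m \<and> j < m \<and> i \<noteq> j}\<rparr>"

definition path_ugraph :: "nat \<Rightarrow> nat ugraph" where
  "path_ugraph n = \<lparr>verts = {..<n}, edges = {{i, Suc i} |i. Suc i < n}\<rparr>"

definition cartesian_product :: "'a ugraph \<Rightarrow> 'b ugraph \<Rightarrow> ('a \<times> 'b) ugraph" where
  "cartesian_product G H =
    \<lparr>verts = verts G \<times> verts H,
     edges = {{(v\<^sub>1, v\<^sub>2), (w\<^sub>1, w\<^sub>2)} |v\<^sub>1 v\<^sub>2 w\<^sub>1 w\<^sub>2.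
       v\<^sub>1 \<in> verts G \<and> w\<^sub>1 \<in> verts G \<and> v\<^sub>2 \<in> verts H \<and> w\<^sub>2 \<in> verts H \<and>
       (v\<^sub>1 = w\<^sub>1 \<and> {v\<^sub>2, w\<^sub>2} \<in> edges H \<or> v\<^sub>2 = w\<^sub>2 \<and> {v\<^sub>1, w\<^sub>1} \<in> edges G)}\<rparr>"

definition connectivity :: "'a ugraph \<Rightarrow> ('a \<times> 'a) set" where
  "connectivity G = {(u, v) \<in> verts G \<times> verts G. (u, v) \<in> {(x, y). {x, y} \<in> edges G}\<^sup>*}"

text \<open>Connected components are represented by their vertex sets.\<close>

definition conn_components :: "'a ugraph \<Rightarrow> 'a set set" where
  "conn_components G = verts G // connectivity G"

definition monochromatic_subgraph :: "'a ugraph \<Rightarrow> ('a \<Rightarrow> 'c) \<Rightarrow> 'a ugraph" where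
  "monochromatic_subgraph G c =
    \<lparr>verts = verts G, edges = {e \<in> edges G. \<forall>u\<in>e. \<forall>v\<in>e. c u = c v}\<rparr>"

definition blocks :: "'a ugraph \<Rightarrow> ('a \<Rightarrow> 'c) \<Rightarrow> 'a set set" where
  "blocks G c = conn_components (monochromatic_subgraph G c)"

text \<open>The colours are \<open>0, \<dots>, k - 1\<close>; outside \<open>verts G\<close> a colouring takes the dummy value \<open>0\<close>.
  For \<open>k = 0\<close> the distribution is meaningless.\<close>

definition random_coloring :: "nat \<Rightarrow> 'a ugraph \<Rightarrow> ('a \<Rightarrow> nat) pmf" where
  "random_coloring k G = Pi_pmf (verts G) 0 (\<lambda>_. pmf_of_set {..<k})"

definition expected_blocks :: "nat \<Rightarrow> 'a ugraph \<Rightarrow> real" where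
  "expected_blocks k G =
    measure_pmf.expectation (random_coloring k G) (\<lambda>c. real (card (blocks G c)))"

end

theory Submission
  imports Defs
begin

text \<open>Vertices of equal colour in one layer of \<open>K\<^sub>m \<times> P\<^sub>n\<close> are adjacent, so a block of colour \<open>a\<close>
  meets a consecutive run of layers, and two blocks of the same colour never share a layer.
  Blocks therefore correspond to pairs \<open>(a, j)\<close> such that \<open>a\<close> occurs in layer \<open>j\<close>
  but no vertex of layer \<open>j\<close> and its predecessor in layer \<open>j - 1\<close> both have colour \<open>a\<close>.
  By linearity of expectation the expected number of blocks of \<open>K\<^sub>m \<times> P\<^sub>n\<close> is
  \<open>k (1 - (1 - 1/k)\<^sup>m) + (n - 1) k ((1 - 1/k\<^sup>2)\<^sup>m - (1 - 1/k)\<^sup>m)\<close>.\<close>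

subsection \<open>Blocks of complete-by-path products\<close>

lemma verts_complete_path:
  "verts (cartesian_product (complete_ugraph m) (path_ugraph n)) = {..<m} \<times> {..<n}"
  by (simp add: cartesian_product_def complete_ugraph_def path_ugraph_def)

lemma edges_complete_path_iff:
  "{(i, j), (i', j')} \<in> edges (cartesian_product (complete_ugraph m) (path_ugraph n)) \<longleftrightarrow>
    i < m \<and> i' < m \<and> j < n \<and> j' < n \<and>
    (i = i' \<and> (j' = Suc j \<or> j = Suc j') \<or> j = j' \<and> i \<noteq> i')"
proof -
  have "{x, y} \<in> edges (complete_ugraph m) \<longleftrightarrow> x < m \<and> y < m \<and> x \<noteq> y" for x y
    by (auto simp: complete_ugraph_def doubleton_eq_iff)
  moreover have "{x, y} \<in> edges (path_ugraph n) \<longleftrightarrow> x < n \<and> y < n \<and> (y = Suc x \<or> x = Suc y)" for x y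
    by (auto simp: path_ugraph_def doubleton_eq_iff)
  moreover have "verts (complete_ugraph m) = {..<m}" "verts (path_ugraph n) = {..<n}"
    by (simp_all add: complete_ugraph_def path_ugraph_def)
  ultimately show ?thesis
    by (auto simp: cartesian_product_def doubleton_eq_iff)
qed

text \<open>One column suffices, since equally coloured vertices of a layer are adjacent. The guard
  \<open>j > 0\<close> matters: with truncated subtraction, layer 0 would count as its own
  predecessor.\<close>

definition continues :: "nat \<Rightarrow> (nat \<times> nat \<Rightarrow> 'c) \<Rightarrow> 'c \<Rightarrow> nat \<Rightarrow> bool" where
  "continues m c a j \<longleftrightarrow> j > 0 \<and> (\<exists>i<m. c (i, j - 1) = a \<and> c (i, j) = a)"

text \<open>For a colour \<open>a\<close> present in layer \<open>j\<close>, this is the lowest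
  layer met by the block of colour \<open>a\<close> through layer \<open>j\<close>.\<close>

fun block_start :: "nat \<Rightarrow> (nat \<times> nat \<Rightarrow> 'c) \<Rightarrow> 'c \<Rightarrow> nat \<Rightarrow> nat" where
  "block_start m c a 0 = 0"
| "block_start m c a (Suc j) = (if continues m c a (Suc j) then block_start m c a j else Suc j)"

lemma block_start_le: "block_start m c a j \<le> j"
  by (induction j) auto

lemma block_start_eq_self: "\<not> continues m c a j \<Longrightarrow> block_start m c a j = j"
  by (cases j) auto

lemma not_continues_block_start: "\<not> continues m c a (block_start m c a j)"
  by (induction j) (auto simp: continues_def)

lemma color_occurs_block_start:
  assumes "\<exists>i<m. c (i, j) = a"
  shows "\<exists>i<m. c (i, block_start m c a j) = a"
  using assms by (induction j) (auto simp: continues_def)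

text \<open>A complete invariant of blocks: blocks of one colour share no layer, so colour and
  lowest layer identify a block.\<close>

definition block_label :: "nat \<Rightarrow> (nat \<times> nat \<Rightarrow> 'c) \<Rightarrow> nat \<times> nat \<Rightarrow> 'c \<times> nat" where
  "block_label m c v = (c v, block_start m c (c v) (snd v))"

lemma image_block_label:
  "block_label m c ` ({..<m} \<times> {..<n}) =
    {(a, j). j < n \<and> (\<exists>i<m. c (i, j) = a) \<and> \<not> continues m c a j}" (is "?L = ?R")
proof
  show "?L \<subseteq> ?R"
  proof
    fix x assume "x \<in> ?L"
    then obtain i j where ij: "i < m" "j < n"
      and x: "x = (c (i, j), block_start m c (c (i, j)) j)"
      by (auto simp: block_label_def)
    have "block_start m c (c (i, j)) j < n"
      using block_start_le[of m c "c (i, j)" j] ij by simp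
    moreover have "\<exists>i'<m. c (i', block_start m c (c (i, j)) j) = c (i, j)"
      using color_occurs_block_start[of m c j "c (i, j)"] ij by blast
    ultimately show "x \<in> ?R"
      using x by (auto simp: not_continues_block_start)
  qed
  show "?R \<subseteq> ?L"
  proof
    fix x assume "x \<in> ?R"
    then obtain i j where ij: "i < m" "j < n" "\<not> continues m c (c (i, j)) j" "x = (c (i, j), j)"
      by auto
    then have "x = block_label m c (i, j)"
      by (simp add: block_label_def block_start_eq_self)
    then show "x \<in> ?L" using ij by auto
  qed
qed

text \<open>Labels are constant along monochromatic edges. Conversely, every vertex can walk down to
  the start layer in its label, where equally labelled vertices meet.\<close>

lemma connectivity_complete_path:
  "connectivity (monochromatic_subgraph (cartesian_product (complete_ugraph m) (path_ugraph n)) c) =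
    {(u, v) \<in> ({..<m} \<times> {..<n}) \<times> ({..<m} \<times> {..<n}). block_label m c u = block_label m c v}"
proof -
  define G where "G = cartesian_product (complete_ugraph m) (path_ugraph n)"
  define R where "R = {(x, y). {x, y} \<in> edges (monochromatic_subgraph G c)}"
  have R_iff: "((i, j), (i', j')) \<in> R \<longleftrightarrow>
      i < m \<and> i' < m \<and> j < n \<and> j' < n \<and> c (i, j) = c (i', j') \<and>
      (i = i' \<and> (j' = Suc j \<or> j = Suc j') \<or> j = j' \<and> i \<noteq> i')" for i j i' j'
    using edges_complete_path_iff[of i j i' j' m n]
    by (auto simp: R_def G_def monochromatic_subgraph_def)
  have "sym R"
    by (auto simp: R_def sym_def insert_commute)
  then have sym: "sym (R\<^sup>*)"
    by (rule sym_rtrancl)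
  \<comment> \<open>A vertical edge in \<open>R\<close> is itself a witness for
    \<open>continues\<close>, so its upper end inherits the start of the lower one.\<close>
  have label_edge: "block_label m c u = block_label m c v" if "(u, v) \<in> R" for u v
    using that by (cases u; cases v) (auto simp: R_iff block_label_def continues_def)
  have label_path: "block_label m c u = block_label m c v" if "(u, v) \<in> R\<^sup>*" for u v
    using that by induction (auto dest: label_edge)
  have layer: "((i, j), (i', j)) \<in> R\<^sup>*"
    if "i < m" "i' < m" "j < n" "c (i, j) = c (i', j)" for i i' j
    using that by (cases "i = i'") (auto simp: R_iff)
  \<comment> \<open>The end column \<open>i'\<close> is free so that two walks can be steered to the
    same vertex; \<open>i\<close> is generalised in the induction because the walk changes
    columns.\<close>
  have to_start: "((i, j), (i', block_start m c (c (i, j)) j)) \<in> R\<^sup>*"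
    if "i < m" "i' < m" "j < n" "c (i', block_start m c (c (i, j)) j) = c (i, j)" for i i' j
    using that
  proof (induction j arbitrary: i)
    case 0
    then show ?case by (auto intro: layer)
  next
    case (Suc j)
    show ?case
    proof (cases "continues m c (c (i, Suc j)) (Suc j)")
      case True
      \<comment> \<open>Walk sideways to a column \<open>l\<close> whose colour persists downwards,
        then descend one layer.\<close>
      then obtain l where l: "l < m" "c (l, j) = c (i, Suc j)" "c (l, Suc j) = c (i, Suc j)"
        by (auto simp: continues_def)
      have "((i, Suc j), (l, Suc j)) \<in> R\<^sup>*"
        using Suc.prems l by (intro layer) auto
      moreover have "((l, Suc j), (l, j)) \<in> R\<^sup>*"
        using Suc.prems l by (intro r_into_rtrancl) (auto simp: R_iff)
      moreover have "((l, j), (i', block_start m c (c (l, j)) j)) \<in> R\<^sup>*"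
        using Suc.prems l True by (intro Suc.IH) auto
      ultimately show ?thesis
        using True l by (auto intro: rtrancl_trans)
    next
      case False
      then show ?thesis using Suc.prems by (auto intro: layer)
    qed
  qed
  have path_if_label: "((i, j), (i', j')) \<in> R\<^sup>*"
    if "i < m" "j < n" "i' < m" "j' < n" "block_label m c (i, j) = block_label m c (i', j')"
    for i j i' j'
  proof -
    obtain l where l: "l < m" "c (l, block_start m c (c (i, j)) j) = c (i, j)"
      using color_occurs_block_start[of m c j "c (i, j)"] \<open>i < m\<close> by blast
    have "((i, j), (l, block_start m c (c (i, j)) j)) \<in> R\<^sup>*"
      using that l by (intro to_start) auto
    moreover have "((i', j'), (l, block_start m c (c (i, j)) j)) \<in> R\<^sup>*"
      using to_start[of i' l j'] that l by (auto simp: block_label_def)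
    ultimately show ?thesis
      using sym by (meson rtrancl_trans symD)
  qed
  have "verts (monochromatic_subgraph G c) = {..<m} \<times> {..<n}"
    by (simp add: monochromatic_subgraph_def G_def verts_complete_path)
  then have "connectivity (monochromatic_subgraph G c) =
      {(u, v) \<in> ({..<m} \<times> {..<n}) \<times> ({..<m} \<times> {..<n}). (u, v) \<in> R\<^sup>*}"
    by (simp add: connectivity_def R_def)
  also have "\<dots> = {(u, v) \<in> ({..<m} \<times> {..<n}) \<times> ({..<m} \<times> {..<n}). block_label m c u = block_label m c v}"
    using label_path path_if_label by fast
  finally show ?thesis
    by (simp add: G_def)
qed

text \<open>The classes are the nonempty fibres of \<open>f\<close>, one for each value in the
  image.\<close>

lemma card_quotient_kernel:
  "card (A // {(u, v) \<in> A \<times> A. f u = f v}) = card (f ` A)"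
proof -
  have "{(u, v) \<in> A \<times> A. f u = f v} `` {x} = {v \<in> A. f v = f x}" if "x \<in> A" for x
    using that by auto
  then have "A // {(u, v) \<in> A \<times> A. f u = f v} = (\<lambda>y. {v \<in> A. f v = y}) ` f ` A"
    by (auto simp: quotient_def)
  moreover have "inj_on (\<lambda>y. {v \<in> A. f v = y}) (f ` A)"
    by (auto simp: inj_on_def)
  ultimately show ?thesis
    by (simp add: card_image)
qed

lemma card_blocks_complete_path:
  "card (blocks (cartesian_product (complete_ugraph m) (path_ugraph n)) c) =
    card {(a, j). j < n \<and> (\<exists>i<m. c (i, j) = a) \<and> \<not> continues m c a j}"
proof -
  have "verts (monochromatic_subgraph (cartesian_product (complete_ugraph m) (path_ugraph n)) c)
      = {..<m} \<times> {..<n}"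
    by (simp add: monochromatic_subgraph_def verts_complete_path)
  then show ?thesis
    by (simp only: blocks_def conn_components_def connectivity_complete_path
        card_quotient_kernel image_block_label)
qed

text \<open>Products over columns suit the expectation: their factors depend on disjoint sets of
  vertices.\<close>

lemma card_blocks_complete_path_sum:
  assumes "\<And>i j. i < m \<Longrightarrow> j < n \<Longrightarrow> c (i, j) < (k :: nat)"
  shows "real (card (blocks (cartesian_product (complete_ugraph m) (path_ugraph n)) c)) =
    (\<Sum>a<k. \<Sum>j<n. (\<Prod>i<m. 1 - (if j = 0 then 0 else of_bool (c (i, j - 1) = a \<and> c (i, j) = a)))
      - (\<Prod>i<m. 1 - of_bool (c (i, j) = a)))" (is "_ = (\<Sum>a<k. \<Sum>j<n. ?F a j)")
proof -
  have of_bool_all: "(\<Prod>i<m. 1 - of_bool (P i)) = (of_bool (\<forall>i<m. \<not> P i) :: real)" for P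
  proof (cases "\<forall>i<m. \<not> P i")
    case False
    then show ?thesis by (auto intro!: prod_zero)
  qed simp
  \<comment> \<open>A colour absent from layer \<open>j\<close> cannot continue into it, so
    subtracting the indicator of absence from that of not continuing leaves the indicator of a block
    start.\<close>
  have F: "?F a j = of_bool ((\<exists>i<m. c (i, j) = a) \<and> \<not> continues m c a j)" for a j
    by (cases "j = 0") (auto simp: of_bool_all continues_def)
  have "{(a, j). j < n \<and> (\<exists>i<m. c (i, j) = a) \<and> \<not> continues m c a j} =
      {x \<in> {..<k} \<times> {..<n}. (\<exists>i<m. c (i, snd x) = fst x) \<and> \<not> continues m c (fst x) (snd x)}"
    using assms by auto
  then have "real (card (blocks (cartesian_product (complete_ugraph m) (path_ugraph n)) c)) =
      (\<Sum>x\<in>{..<k} \<times> {..<n}. of_bool ((\<exists>i<m. c (i, snd x) = fst x) \<and> \<not> continues m c (fst x) (snd x)))"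
    by (simp add: card_blocks_complete_path of_bool_def sum.If_cases Int_def)
  also have "\<dots> = (\<Sum>a<k. \<Sum>j<n. ?F a j)"
    by (simp only: F sum.cartesian_product split_def)
  finally show ?thesis .
qed

subsection \<open>Expectation\<close>

text \<open>Finite support makes every real function of the colouring integrable, as linearity
  requires.\<close>

lemma finite_set_Pi_pmf_uniform:
  assumes "finite V" "k \<ge> 1"
  shows "finite (set_pmf (Pi_pmf V (0::nat) (\<lambda>_. pmf_of_set {..<k})))"
  using assms by (subst set_Pi_pmf) (auto simp: lessThan_empty_iff intro!: finite_PiE_dflt)

lemma expectation_prod_color:
  assumes "finite V" "C \<subseteq> V" "a < k"
  shows "measure_pmf.expectation (Pi_pmf V 0 (\<lambda>_. pmf_of_set {..<k}))
    (\<lambda>c. \<Prod>v\<in>C. of_bool (c v = a) :: real) = 1 / real k ^ card C"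
proof -
  \<comment> \<open>Factors 1 outside \<open>C\<close> extend the product to all of
    \<open>V\<close>, the index set of the independent colours.\<close>
  have "measure_pmf.expectation (Pi_pmf V 0 (\<lambda>_. pmf_of_set {..<k}))
      (\<lambda>c. \<Prod>v\<in>V. if v \<in> C then of_bool (c v = a) else (1::real)) =
    (\<Prod>v\<in>V. measure_pmf.expectation (pmf_of_set {..<k})
      (\<lambda>x. if v \<in> C then of_bool (x = a) else (1::real)))"
    using assms by (intro expectation_prod_Pi_pmf integrable_measure_pmf_finite) (auto simp: lessThan_empty_iff)
  also have "\<dots> = (\<Prod>v\<in>V. if v \<in> C then 1 / real k else 1)"
  proof (intro prod.cong refl)
    fix v assume "v \<in> V"
    have "(\<Sum>x<k. of_bool (x = a)) = (1::real)"
      using assms by (simp add: of_bool_def)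
    then show "measure_pmf.expectation (pmf_of_set {..<k})
      (\<lambda>x. if v \<in> C then of_bool (x = a) else (1::real)) = (if v \<in> C then 1 / real k else 1)"
      using assms by (auto simp: integral_pmf_of_set lessThan_empty_iff)
  qed
  also have "\<dots> = 1 / real k ^ card C"
    using assms by (simp add: prod.If_cases Int_absorb1 power_one_over)
  also have "(\<lambda>c :: 'a \<Rightarrow> nat. \<Prod>v\<in>V. if v \<in> C then of_bool (c v = a) else (1::real)) =
      (\<lambda>c. \<Prod>v\<in>C. of_bool (c v = a))"
    using assms by (simp add: prod.If_cases Int_absorb1)
  finally show ?thesis .
qed

text \<open>Expanding the product over \<open>i\<close> (inclusion-exclusion) leaves only products over single
  vertices, for which independence is immediate.\<close>

lemma expectation_prod_not_constant:
  assumes "finite V" "finite I" "\<And>i. i \<in> I \<Longrightarrow> B i \<subseteq> V" "disjoint_family_on B I"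
    and "\<And>i. i \<in> I \<Longrightarrow> card (B i) = b" "a < k"
  shows "measure_pmf.expectation (Pi_pmf V 0 (\<lambda>_. pmf_of_set {..<k}))
    (\<lambda>c. \<Prod>i\<in>I. 1 - (\<Prod>v\<in>B i. of_bool (c v = a)) :: real) = (1 - 1 / real k ^ b) ^ card I"
proof -
  let ?M = "Pi_pmf V 0 (\<lambda>_. pmf_of_set {..<k})"
  have fin: "finite (set_pmf ?M)"
    using assms by (intro finite_set_Pi_pmf_uniform) auto
  have expand: "(\<Prod>i\<in>I. 1 - g i) = (\<Sum>S\<in>Pow I. (-1) ^ card S * (\<Prod>i\<in>S. g i))" for g :: "'b \<Rightarrow> real"
    using prod_add[OF \<open>finite I\<close>, of "\<lambda>i. - g i" "\<lambda>_. 1"]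
    by (simp add: prod_uminus)
  have "measure_pmf.expectation ?M (\<lambda>c. \<Prod>i\<in>I. 1 - (\<Prod>v\<in>B i. of_bool (c v = a)) :: real) =
     (\<Sum>S\<in>Pow I. (-1) ^ card S * measure_pmf.expectation ?M (\<lambda>c. \<Prod>i\<in>S. \<Prod>v\<in>B i. of_bool (c v = a)))"
    by (simp add: expand integrable_measure_pmf_finite[OF fin])
  also have "\<dots> = (\<Sum>S\<in>Pow I. (-1) ^ card S * (\<Prod>i\<in>S. 1 / real k ^ b))"
  proof (intro sum.cong refl arg_cong2[of _ _ _ _ "(*)"])
    fix S assume "S \<in> Pow I"
    then have S: "S \<subseteq> I" "finite S"
      using \<open>finite I\<close> by (auto intro: finite_subset)
    have finB: "finite (B i)" if "i \<in> S" for i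
      using that S assms(3)[of i] \<open>finite V\<close> by (auto intro: finite_subset)
    have disj: "\<forall>i\<in>S. \<forall>j\<in>S. i \<noteq> j \<longrightarrow> B i \<inter> B j = {}"
      using S assms(4) by (auto simp: disjoint_family_on_def)
    \<comment> \<open>Disjointness merges the double product into one over \<open>b * card S\<close>
      distinct vertices.\<close>
    have "(\<Prod>i\<in>S. \<Prod>v\<in>B i. of_bool (c v = a) :: real) = (\<Prod>v\<in>(\<Union>i\<in>S. B i). of_bool (c v = a))"
      for c :: "'a \<Rightarrow> nat"
      using S finB disj by (subst prod.UNION_disjoint) auto
    moreover have "card (\<Union>i\<in>S. B i) = b * card S"
      using S finB disj assms(5) by (subst card_UN_disjoint) (auto simp: subset_iff)
    moreover have "(\<Union>i\<in>S. B i) \<subseteq> V"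
      using S assms(3) by blast
    ultimately show "measure_pmf.expectation ?M (\<lambda>c. \<Prod>i\<in>S. \<Prod>v\<in>B i. of_bool (c v = a)) =
        (\<Prod>i\<in>S. 1 / real k ^ b)"
      using expectation_prod_color[OF \<open>finite V\<close> _ \<open>a < k\<close>, of "\<Union>i\<in>S. B i"]
      by (simp add: power_mult power_one_over)
  qed
  \<comment> \<open>The expansion read backwards, with every \<open>g i\<close> equal to
    \<open>1 / real k ^ b\<close>.\<close>
  also have "\<dots> = (1 - 1 / real k ^ b) ^ card I"
    by (subst expand[symmetric]) simp
  finally show ?thesis .
qed

lemma expected_blocks_complete_path:
  assumes "k \<ge> 1" "n \<ge> 1"
  shows "expected_blocks k (cartesian_product (complete_ugraph m) (path_ugraph n)) =
    real k * (1 - (1 - 1 / real k) ^ m)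
    + (real n - 1) * (real k * ((1 - 1 / real k ^ 2) ^ m - (1 - 1 / real k) ^ m))"
proof -
  let ?V = "{..<m} \<times> {..<n}"
  let ?M = "Pi_pmf ?V 0 (\<lambda>_. pmf_of_set {..<k})"
  let ?P = "\<lambda>a j c. \<Prod>i<m. 1 - (if j = 0 then 0 else of_bool (c (i, j - 1) = a \<and> c (i, j) = a)) :: real"
  let ?Q = "\<lambda>a j c. \<Prod>i<m. 1 - of_bool (c (i, j) = a) :: real"
  have fin: "finite (set_pmf ?M)"
    using assms by (intro finite_set_Pi_pmf_uniform) auto
  have Q: "measure_pmf.expectation ?M (?Q a j) = (1 - 1 / real k) ^ m" if "a < k" "j < n" for a j
    using expectation_prod_not_constant[of ?V "{..<m}" "\<lambda>i. {(i, j)}" 1 a k] that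
    by (auto simp: disjoint_family_on_def)
  \<comment> \<open>Each column now contributes its vertices in layers \<open>j - 1\<close> and
    \<open>j\<close>, hence \<open>b = 2\<close> instead of 1; layer 0 has no predecessor, so all
    factors are 1 there.\<close>
  have P: "measure_pmf.expectation ?M (?P a j) = (if j = 0 then 1 else (1 - 1 / real k ^ 2) ^ m)"
    if "a < k" "j < n" for a j
  proof (cases "j = 0")
    case False
    then have ne: "j - 1 \<noteq> j" by simp
    show ?thesis
      using expectation_prod_not_constant[of ?V "{..<m}" "\<lambda>i. {(i, j - 1), (i, j)}" 2 a k] that False ne
      by (auto simp: disjoint_family_on_def of_bool_conj card_insert_if)
  qed simp
  have "expected_blocks k (cartesian_product (complete_ugraph m) (path_ugraph n)) =
      measure_pmf.expectation ?M (\<lambda>c. \<Sum>a<k. \<Sum>j<n. ?P a j c - ?Q a j c)"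
    unfolding expected_blocks_def random_coloring_def verts_complete_path
  proof (intro integral_cong_AE)
    \<comment> \<open>Colours are below \<open>k\<close> only on the support, hence equality almost
      everywhere.\<close>
    show "AE c in ?M. real (card (blocks (cartesian_product (complete_ugraph m) (path_ugraph n)) c)) =
        (\<Sum>a<k. \<Sum>j<n. ?P a j c - ?Q a j c)"
    proof (rule AE_pmfI)
      fix c assume "c \<in> set_pmf ?M"
      then have "c \<in> PiE_dflt ?V 0 (\<lambda>_. {..<k})"
        using assms by (simp add: set_Pi_pmf lessThan_empty_iff)
      then have "c (i, j) < k" if "i < m" "j < n" for i j
        using that by (auto simp: PiE_dflt_def)
      then show "real (card (blocks (cartesian_product (complete_ugraph m) (path_ugraph n)) c)) =
        (\<Sum>a<k. \<Sum>j<n. ?P a j c - ?Q a j c)"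
        by (rule card_blocks_complete_path_sum)
    qed
  qed simp_all
  also have "\<dots> = (\<Sum>a<k. \<Sum>j<n. measure_pmf.expectation ?M (?P a j) - measure_pmf.expectation ?M (?Q a j))"
    by (simp add: integrable_measure_pmf_finite[OF fin])
  also have "\<dots> = real k * (\<Sum>j<n. (if j = 0 then 1 else (1 - 1 / real k ^ 2) ^ m) - (1 - 1 / real k) ^ m)"
    by (simp add: P Q)
  \<comment> \<open>Layer 0 is split off; the other \<open>n - 1\<close> layers contribute
    equally.\<close>
  also have "{..<n} = insert 0 {1..<n}"
    using assms by auto
  finally show ?thesis
    using assms by (simp add: algebra_simps)
qed

theorem corollary6p2:
  fixes k n :: nat
  assumes "k \<ge> 1" and "n \<ge> 1"
  shows "expected_blocks k (cartesian_product (complete_ugraph 3) (path_ugraph n)) =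
    real k powi (3 * int n - 5) *
      ((1 - 3 * real k ^ 2 + 3 * real k ^ 4)
        - (1 - real k) ^ 3 * (1 + 3 * real k + 3 * real k ^ 2) * real n)
    / real k ^ (3 * n)"
proof -
  have k: "real k \<noteq> 0"
    using assms by simp
  \<comment> \<open>For \<open>n = 1\<close> the exponent is \<open>-2\<close>, hence the integer
    power. Splitting off the fifth power lets \<open>real k ^ (3 * n)\<close> cancel.\<close>
  have "real k powi (3 * int n - 5) = real k powi int (3 * n) / real k powi int 5"
    using k by (subst power_int_diff[symmetric]) simp_all
  then have "real k powi (3 * int n - 5) = real k ^ (3 * n) / real k ^ 5"
    by (simp only: power_int_of_nat)
  then have powi: "real k powi (3 * int n - 5) * x / real k ^ (3 * n) = x / real k ^ 5" for x
    using k by (simp add: field_simps)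
  show ?thesis
    unfolding powi expected_blocks_complete_path[OF assms]
    \<comment> \<open>With \<open>m = 3\<close>, clearing denominators leaves a polynomial identity
      in \<open>real k\<close> and \<open>real n\<close>.\<close>
    using k by (simp add: field_simps) algebra
qed

end
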